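(* Let $H=(\sigma,\alpha)$ be a connected orientable hypermap. If there exists $E'\subseteq E(H)$ such that the partial dual $H^{E'}$ is bipartite, then every hyperedge of $H$ must have even length.
   Context: Permutations are composed from right to left. A connected orientable hypermap is a pair $H=(\sigma,\alpha)$ of permutations of a finite set $D=\{1,\dots,n\}$ of darts such that the group generated by $\sigma,\alpha$ acts transitively on $D$. Vertices are the cycles of $\sigma$ and hyperedges are the cycles of $\alpha$ (fixed points count as cycles of length 1); $E(H)$ is the set of hyperedges, and the length of a hyperedge is the length of the corresponding cycle. For a dart $i$, $v(i)$ is the $\sigma$-cycle containing $i$. $H$ is bipartite if its vertex-adjacency graph $\Gamma(H)$ is bipartite (2-colorable), where $\Gamma(H)$ has the vertices of $H$ as vertices and, for each dart $i\in D$, an edge joining $v(i)$ to $v(\alpha(i))$ (loops and multiple edges allowed; a loop prevents bipartiteness). For $E'\subseteq E(H)$, let $\alpha_{E'}$ be the product of the $\alpha$-cycles in $E'$ and $\alpha_{\overline{E'}}$ the product of the remaining $\alpha$-cycles. The partial dual is the hypermap $H^{E'}=(\sigma^{E'},\alpha^{E'})$ with vertex permutation $\sigma^{E'}=\alpha_{E'}^{-1}\sigma$ and hyperedge permutation $\alpha^{E'}=\alpha_{E'}^{-1}\alpha_{\overline{E'}}$. *)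

theory Defs
  imports "HOL-Combinatorics.Orbits" "HOL-Algebra.Sym_Groups"
begin

section \<open>Hypermaps\<close>

record hypermap =
  ndarts :: nat
  vperm :: "nat \<Rightarrow> nat"
  hperm :: "nat \<Rightarrow> nat"

definition darts :: "hypermap \<Rightarrow> nat set" where
  "darts H = {1..ndarts H}"

definition connected_hypermap :: "hypermap \<Rightarrow> bool" where
  "connected_hypermap H \<longleftrightarrow>
     vperm H permutes darts H \<and> hperm H permutes darts H \<and>
     (\<forall>i\<in>darts H. \<forall>j\<in>darts H.
        \<exists>g\<in>generate (sym_group (ndarts H)) {vperm H, hperm H}. g i = j)"

text \<open>
  A cycle of a permutation is represented by its set of darts, i.e. by an orbit. This set determines
  the cycle, and the length of the cycle is its cardinality. (Cycles represented as permutations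
  would identify all fixed points, since each of these gives the identity.)
\<close>

definition vertex_of :: "hypermap \<Rightarrow> nat \<Rightarrow> nat set" where
  "vertex_of H i = orbit (vperm H) i"

definition vertices :: "hypermap \<Rightarrow> nat set set" where
  "vertices H = vertex_of H ` darts H"

definition hyperedges :: "hypermap \<Rightarrow> nat set set" where
  "hyperedges H = orbit (hperm H) ` darts H"

definition hyperedge_length :: "nat set \<Rightarrow> nat" where
  "hyperedge_length e = card e"


section \<open>The vertex-adjacency graph\<close>

text \<open>
  Undirected multigraphs: the value of \<open>ends\<close> at an edge is the set of its end vertices, which is a
  singleton for a loop.
\<close>

record ('v, 'e) multigraph =
  nodes :: "'v set"
  links :: "'e set"
  ends :: "'e \<Rightarrow> 'v set"

definition two_colorable :: "('v, 'e) multigraph \<Rightarrow> bool" where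
  "two_colorable G \<longleftrightarrow>
     (\<exists>c :: 'v \<Rightarrow> bool. \<forall>e\<in>links G. \<forall>x y. ends G e = {x, y} \<longrightarrow> c x \<noteq> c y)"

definition adjacency_graph :: "hypermap \<Rightarrow> (nat set, nat) multigraph" where
  "adjacency_graph H =
     \<lparr>nodes = vertices H, links = darts H,
      ends = (\<lambda>i. {vertex_of H i, vertex_of H (hperm H i)})\<rparr>"

definition bipartite :: "hypermap \<Rightarrow> bool" where
  "bipartite H \<longleftrightarrow> two_colorable (adjacency_graph H)"


section \<open>Partial duals\<close>

text \<open>
  If \<open>e\<close> is a cycle of \<open>p\<close>, then \<^term>\<open>perm_restrict p e\<close> is that cycle as a permutation of all
  darts. Disjoint cycles commute, so the product over a finite set of cycles of \<open>p\<close> does not depend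
  on the order of the factors.
\<close>

definition cycle_product :: "(nat \<Rightarrow> nat) \<Rightarrow> nat set set \<Rightarrow> (nat \<Rightarrow> nat)" where
  "cycle_product p C = Finite_Set.fold (\<lambda>e q. perm_restrict p e \<circ> q) id C"

definition partial_dual :: "hypermap \<Rightarrow> nat set set \<Rightarrow> hypermap" where
  "partial_dual H E' =
     (let a = cycle_product (hperm H) E';
          b = cycle_product (hperm H) (hyperedges H - E')
      in H\<lparr>vperm := inv' a \<circ> vperm H, hperm := inv' a \<circ> b\<rparr>)"

lemma cycle_product_eq_perm_restrict:
  assumes p: "p permutes D" "finite D" and C: "C \<subseteq> orbit p ` D"
  shows "cycle_product p C = perm_restrict p (\<Union>C)"
proof -
  have perm: "permutation p" using p unfolding permutation_permutes by blast
  have cyc: "cyclic_on p e" if "e \<in> orbit p ` D" for e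
    using that cyclic_on_orbit'[OF perm] by auto
  have disj: "e \<inter> f = {}" if "e \<in> orbit p ` D" "f \<in> orbit p ` D" "e \<noteq> f" for e f
  proof (rule ccontr)
    assume "e \<inter> f \<noteq> {}"
    then obtain x where x: "x \<in> e" "x \<in> f" by blast
    have "orbit p x = e" by (rule orbit_cyclic_eq3[OF cyc[OF that(1)] x(1)])
    moreover have "orbit p x = f" by (rule orbit_cyclic_eq3[OF cyc[OF that(2)] x(2)])
    ultimately show False using that(3) by simp
  qed
  interpret comp_fun_commute_on "orbit p ` D" "\<lambda>e q. perm_restrict p e \<circ> q"
  proof
    fix e f assume e: "e \<in> orbit p ` D" and f: "f \<in> orbit p ` D"
    have "perm_restrict p f \<circ> perm_restrict p e = perm_restrict p e \<circ> perm_restrict p f"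
    proof (cases "e = f")
      case False
      then have "f \<inter> e = {}" "e \<inter> f = {}" using disj[OF e f] disj[OF f e] by simp_all
      then show ?thesis
        using perm_restrict_comp[OF _ cyc[OF e], of f] perm_restrict_comp[OF _ cyc[OF f], of e]
        by (simp add: Un_commute)
    qed simp
    then show "(\<circ>) (perm_restrict p f) \<circ> (\<circ>) (perm_restrict p e) =
        (\<circ>) (perm_restrict p e) \<circ> (\<circ>) (perm_restrict p f)"
      by (simp add: o_def fun_eq_iff)
  qed
  have "finite C" using finite_subset[OF C] p(2) by simp
  then show ?thesis using C
  proof (induction C rule: finite_induct)
    case empty
    then show ?case by (simp add: cycle_product_def perm_restrict_def fun_eq_iff)
  next
    case (insert e C)
    have d: "\<Union>C \<inter> e = {}"
    proof -
      have "f \<inter> e = {}" if "f \<in> C" for f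
        using that insert.prems insert.hyps by (intro disj) auto
      then show ?thesis by blast
    qed
    have "cycle_product p (insert e C) = perm_restrict p e \<circ> cycle_product p C"
      unfolding cycle_product_def using insert.prems insert.hyps by (intro fold_insert) simp_all
    also have "\<dots> = perm_restrict p e \<circ> perm_restrict p (\<Union>C)"
      using insert.IH insert.prems by simp
    also have "\<dots> = perm_restrict p (\<Union>(insert e C))"
    proof
      fix x
      have "p x \<notin> e" if "x \<in> \<Union>C"
      proof -
        obtain f where f: "f \<in> C" "x \<in> f" using \<open>x \<in> \<Union>C\<close> by blast
        then have "p x \<in> f"
          using cyclic_on_inI[OF cyc[of f], of x] subsetD[OF insert.prems, of f] by simp
        then show ?thesis using d f by blast
      qed
      then show "(perm_restrict p e \<circ> perm_restrict p (\<Union>C)) x =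
          perm_restrict p (\<Union>(insert e C)) x"
        by (auto simp: perm_restrict_def)
    qed
    finally show ?case .
  qed
qed

end

theory Submission
  imports Defs
begin

text \<open>
  Every cycle of the hyperedge permutation of a partial dual is a cycle of \<open>\<alpha>\<close>, traversed backwards
  if it belongs to \<open>E'\<close> and forwards otherwise. A proper 2-colouring of the vertices of the dual,
  pulled back to the darts, changes at every step along such a cycle
  (\<open>bipartite_partial_dual_alternates\<close>); since reversing a cycle does not affect this, the colour
  also changes at every step along every cycle of \<open>\<alpha>\<close>. Hence \<open>\<alpha>\<close> exchanges the two colour classes
  inside each hyperedge, and the hyperedge has even length (\<open>even_card_if_alternating\<close>).
\<close>

text \<open>
  A permutation of \<open>A\<close> that exchanges the two classes of a bipartition of \<open>A\<close> restricts to a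
  bijection between them.
\<close>

lemma even_card_if_alternating:
  assumes fin: "finite A" and inj: "inj_on p A" and img: "p ` A = A"
    and alt: "\<And>x. x \<in> A \<Longrightarrow> d (p x) \<noteq> (d x :: bool)"
  shows "even (card A)"
proof -
  let ?T = "{x \<in> A. d x}" and ?F = "{x \<in> A. \<not> d x}"
  have "p ` ?T = ?F"
  proof
    show "p ` ?T \<subseteq> ?F" using img alt by blast
    show "?F \<subseteq> p ` ?T"
    proof
      fix y assume y: "y \<in> ?F"
      then obtain x where "x \<in> A" "y = p x" using img by blast
      with y alt[of x] show "y \<in> p ` ?T" by auto
    qed
  qed
  moreover have "inj_on p ?T" using inj by (rule inj_on_subset) blast
  ultimately have eq: "card ?F = card ?T" using card_image by metis
  have "card A = card (?T \<union> ?F)" by (rule arg_cong[of _ _ card]) blast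
  also have "\<dots> = card ?T + card ?F" using fin by (intro card_Un_disjoint) auto
  finally show ?thesis using eq by simp
qed

text \<open>
  This is what makes the restriction of \<open>p\<close> to a union of its cycles injective, and what keeps the
  restrictions to two disjoint unions of cycles from interfering.
\<close>

lemma orbits_union_closed:
  assumes p: "p permutes D" "finite D" and C: "C \<subseteq> orbit p ` D"
  shows "p x \<in> \<Union>C \<longleftrightarrow> x \<in> \<Union>C"
proof -
  have perm: "permutation p" using p unfolding permutation_permutes by blast
  have "p x \<in> e \<longleftrightarrow> x \<in> e" if e: "e \<in> C" for e
  proof -
    obtain i where "e = orbit p i" using C e by blast
    then show ?thesis
      using cyclic_on_orbit'[OF perm, of i] by (metis cyclic_on_f_in cyclic_on_inI p(1))
  qed
  then show ?thesis by blast
qed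

lemma Union_hyperedges:
  assumes "hperm H permutes darts H"
  shows "\<Union>(hyperedges H) = darts H"
proof -
  have fin: "finite (darts H)" by (simp add: darts_def)
  have perm: "permutation (hperm H)"
    using assms fin unfolding permutation_permutes by blast
  show ?thesis
    unfolding hyperedges_def
    using permutes_orbit_subset[OF assms] permutation_self_in_orbit[OF perm] by blast
qed

text \<open>
  With \<open>a = \<alpha>\<^bsub>E'\<^esub>\<close> and \<open>b\<close> the product of the remaining cycles, the hyperedge permutation of the
  dual is \<open>a\<inverse>b\<close>. Outside \<open>E'\<close> the factor \<open>b\<close> acts as \<open>\<alpha>\<close> and \<open>a\<close> fixes the result; on \<open>E'\<close> the
  factor \<open>b\<close> is trivial and \<open>a\<inverse>\<close> acts as \<open>\<alpha>\<inverse>\<close>. The second case is stated at the image of \<open>i\<close>, which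
  avoids mentioning the inverse of \<open>\<alpha>\<close>.
\<close>

lemma hperm_partial_dual:
  assumes p: "hperm H permutes darts H" and E: "E' \<subseteq> hyperedges H" and i: "i \<in> darts H"
  shows "i \<notin> \<Union>E' \<Longrightarrow> hperm (partial_dual H E') i = hperm H i"
    and "i \<in> \<Union>E' \<Longrightarrow> hperm (partial_dual H E') (hperm H i) = i"
proof -
  let ?p = "hperm H" and ?R = "hyperedges H - E'"
  let ?a = "perm_restrict ?p (\<Union>E')" and ?b = "perm_restrict ?p (\<Union>?R)"
  have fin: "finite (darts H)" by (simp add: darts_def)
  have perm: "permutation ?p" using p fin unfolding permutation_permutes by blast
  have E1: "E' \<subseteq> orbit ?p ` darts H" and E2: "?R \<subseteq> orbit ?p ` darts H"
    using E by (auto simp: hyperedges_def)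
  have dual: "hperm (partial_dual H E') = inv' ?a \<circ> ?b"
    unfolding partial_dual_def Let_def
    using cycle_product_eq_perm_restrict[OF p fin E1] cycle_product_eq_perm_restrict[OF p fin E2]
    by simp
  note cl1 = orbits_union_closed[OF p fin E1] and cl2 = orbits_union_closed[OF p fin E2]
  have inj: "inj ?a"
  proof (rule injI)
    fix x y assume "?a x = ?a y"
    then show "x = y"
      using cl1[of x] cl1[of y] permutes_inj[OF p]
      by (auto simp: perm_restrict_def inj_eq split: if_splits)
  qed
  have disj: "\<Union>E' \<inter> \<Union>?R = {}"
  proof (rule ccontr)
    assume "\<Union>E' \<inter> \<Union>?R \<noteq> {}"
    then obtain x e f where x: "e \<in> E'" "f \<in> ?R" "x \<in> e" "x \<in> f" by blast
    have "orbit ?p x = g" if "g \<in> hyperedges H" "x \<in> g" for g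
      using that cyclic_on_orbit'[OF perm] orbit_cyclic_eq3 unfolding hyperedges_def by fastforce
    then show False using x E by blast
  qed
  have un: "\<Union>E' \<union> \<Union>?R = darts H" using E Union_hyperedges[OF p] by blast
  show "hperm (partial_dual H E') i = ?p i" if "i \<notin> \<Union>E'"
  proof -
    have "?b i = ?p i" using that i un by (auto simp: perm_restrict_def)
    moreover have "?a (?p i) = ?p i" using that cl1[of i] by (simp add: perm_restrict_def)
    ultimately show ?thesis using inj by (metis dual comp_apply inv_f_f)
  qed
  show "hperm (partial_dual H E') (?p i) = i" if "i \<in> \<Union>E'"
  proof -
    have "?p i \<notin> \<Union>?R" using that cl1[of i] disj by blast
    then have "?b (?p i) = ?p i" by (simp add: perm_restrict_def)
    moreover have "?a i = ?p i" using that by (simp add: perm_restrict_def)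
    ultimately show ?thesis using inj by (metis dual comp_apply inv_f_f)
  qed
qed

lemma bipartite_partial_dual_alternates:
  assumes p: "hperm H permutes darts H" and E: "E' \<subseteq> hyperedges H"
    and bip: "bipartite (partial_dual H E')"
  obtains d :: "nat \<Rightarrow> bool" where "\<And>i. i \<in> darts H \<Longrightarrow> d (hperm H i) \<noteq> d i"
proof -
  let ?K = "partial_dual H E'"
  have D: "darts ?K = darts H" by (simp add: darts_def partial_dual_def Let_def)
  obtain c :: "nat set \<Rightarrow> bool"
    where c: "\<And>i. i \<in> darts H \<Longrightarrow> c (vertex_of ?K i) \<noteq> c (vertex_of ?K (hperm ?K i))"
    using bip unfolding bipartite_def two_colorable_def adjacency_graph_def by (auto simp: D)
  have "c (vertex_of ?K (hperm H i)) \<noteq> c (vertex_of ?K i)" if i: "i \<in> darts H" for i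
  proof (cases "i \<in> \<Union>E'")
    case True
    \<comment> \<open>The dual traverses this cycle backwards, so the edge to use is the one at the image of \<open>i\<close>.\<close>
    have "hperm H i \<in> darts H" using i permutes_in_image[OF p] by blast
    then show ?thesis using c[of "hperm H i"] hperm_partial_dual(2)[OF p E i True] by simp
  next
    case False
    then show ?thesis using c[OF i] hperm_partial_dual(1)[OF p E i] by simp
  qed
  then show ?thesis by (rule that)
qed

theorem corollary2p6:
  fixes H :: hypermap
  assumes "connected_hypermap H"
    and "\<exists>E' \<subseteq> hyperedges H. bipartite (partial_dual H E')"
  shows "\<forall>e \<in> hyperedges H. even (hyperedge_length e)"
proof
  fix e assume e: "e \<in> hyperedges H"
  have p: "hperm H permutes darts H" using assms(1) by (simp add: connected_hypermap_def)
  have fin: "finite (darts H)" by (simp add: darts_def)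
  have perm: "permutation (hperm H)" using p fin unfolding permutation_permutes by blast
  obtain d :: "nat \<Rightarrow> bool" where d: "\<And>i. i \<in> darts H \<Longrightarrow> d (hperm H i) \<noteq> d i"
    using assms(2) bipartite_partial_dual_alternates[OF p] by metis
  have sub: "e \<subseteq> darts H" using e Union_hyperedges[OF p] by blast
  have fin_e: "finite e" using finite_subset[OF sub fin] .
  have "cyclic_on (hperm H) e"
    using e cyclic_on_orbit'[OF perm] by (auto simp: hyperedges_def)
  then have closed: "hperm H ` e \<subseteq> e" using cyclic_on_inI by fast
  have inj: "inj_on (hperm H) e" using permutes_inj[OF p] by (rule inj_on_subset) simp
  show "even (hyperedge_length e)"
    unfolding hyperedge_length_def
    using fin_e inj endo_inj_surj[OF fin_e closed inj] d sub
    by (intro even_card_if_alternating[of e "hperm H" d]) auto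
qed

end
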